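(* Let $d\in\mathbb{N}$, let $R,S$ be finite subsets of $\mathbb{Z}^d\setminus\{\mathbf 0\}$, let $(\phi_{\mathbf n})_{\mathbf n\in R},(\theta_{\mathbf n})_{\mathbf n\in S}\subset\mathbb{C}$, and let $(Z_{\mathbf t})_{\mathbf t\in\mathbb{Z}^d}$ be an i.i.d. complex-valued random field. The ARMA equation $$Y_{\mathbf t}-\sum_{\mathbf n\in R}\phi_{\mathbf n}Y_{\mathbf t-\mathbf n}=Z_{\mathbf t}+\sum_{\mathbf n\in S}\theta_{\mathbf n}Z_{\mathbf t-\mathbf n},\qquad \mathbf t\in\mathbb{Z}^d,$$ admits a linear strictly stationary solution if and only if both of the following hold: (a) $\Theta(e^{-i\,\cdot})/\Phi(e^{-i\,\cdot})\in L^2(\mathbb{T}^d)$; (b) the series $$Y_{\mathbf t}=\sum_{\mathbf k\in\mathbb{Z}^d}\psi_{\mathbf k}Z_{\mathbf t-\mathbf k},\qquad \mathbf t\in\mathbb{Z}^d,$$ converges almost surely absolutely, where $$\frac{\Theta(e^{-i\mathbf t})}{\Phi(e^{-i\mathbf t})}=\sum_{\mathbf k\in\mathbb{Z}^d}\psi_{\mathbf k}e^{-i\mathbf k\cdot\mathbf t},\qquad \mathbf t\in\mathbb{T}^d,$$ denotes the Fourier expansion of $\Theta(e^{-i\,\cdot})/\Phi(e^{-i\,\cdot})$. If these two conditions are satisfied, then a linear strictly stationary solution is given by $Y_{\mathbf t}=\sum_{\mathbf k\in\mathbb{Z}^d}\psi_{\mathbf k}Z_{\mathbf t-\mathbf k}$,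 $\mathbf t\in\mathbb{Z}^d$.
   Context: Notation: $\mathbf z^{\mathbf n}=z_1^{n_1}\cdots z_d^{n_d}$, $e^{-i\mathbf t}=(e^{-it_1},\dots,e^{-it_d})$, $\mathbf k\cdot\mathbf t=\sum_i k_it_i$, and $\mathbb{T}^d$ is the $d$-fold product of $\mathbb{T}=\mathbb{R}/2\pi\mathbb{Z}$, identified with $(-\pi,\pi]^d$ and equipped with Lebesgue measure $\lambda^d$; $L^2(\mathbb{T}^d)$ is the space of complex-valued functions on $\mathbb{T}^d$ that are square integrable with respect to $\lambda^d$. The autoregressive and moving average polynomials are $$\Phi(\mathbf z)=1-\sum_{\mathbf n\in R}\phi_{\mathbf n}\mathbf z^{\mathbf n},\qquad \Theta(\mathbf z)=1+\sum_{\mathbf n\in S}\theta_{\mathbf n}\mathbf z^{\mathbf n}$$ (negative exponents are allowed). The quotient $\Theta(e^{-i\,\cdot})/\Phi(e^{-i\,\cdot})$ is regarded as a function defined $\lambda^d$-almost everywhere on $\mathbb{T}^d$. A complex-valued random field $(Y_{\mathbf t})_{\mathbf t\in\mathbb{Z}^d}$ (on the same probability space as $(Z_{\mathbf t})$) solving the ARMA equation is called a linear strictly stationary solution if there are coefficients $(\psi_{\mathbf k})_{\mathbf k\in\mathbb{Z}^d}\subset\mathbb{C}$ such that $Y_{\mathbf t}=\sum_{\mathbf k\in\mathbb{Z}^d}\psi_{\mathbf k}Z_{\mathbf t-\mathbf k}$ for all $\mathbf t\in\mathbb{Z}^d$, where the right-hand side converges almost surely absolutely.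
   Formalization: The "only if" direction is asserted only when Z is not almost surely constant; it fails for constant noise (e.g. Z=0, d=1, Φ(z)=1−z, Θ=1, Y=0). The "if" direction and the explicit solution hold for every i.i.d. Z. *)

theory Defs
  imports "HOL-Probability.Probability"
begin

definition multi_power :: "complex ^ 'd::finite \<Rightarrow> int ^ 'd \<Rightarrow> complex"
  where "multi_power z n = (\<Prod>i\<in>UNIV. (z $ i) powi (n $ i))"

definition ar_poly :: "(int ^ 'd::finite) set \<Rightarrow> (int ^ 'd \<Rightarrow> complex) \<Rightarrow> complex ^ 'd \<Rightarrow> complex"
  where "ar_poly R \<phi> z = 1 - (\<Sum>n\<in>R. \<phi> n * multi_power z n)"

definition ma_poly :: "(int ^ 'd::finite) set \<Rightarrow> (int ^ 'd \<Rightarrow> complex) \<Rightarrow> complex ^ 'd \<Rightarrow> complex"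
  where "ma_poly S \<theta> z = 1 + (\<Sum>n\<in>S. \<theta> n * multi_power z n)"

definition exp_neg_i :: "real ^ 'd::finite \<Rightarrow> complex ^ 'd"
  where "exp_neg_i t = (\<chi> i. exp (- (\<i> * of_real (t $ i))))"

definition freq_dot :: "int ^ 'd::finite \<Rightarrow> real ^ 'd \<Rightarrow> real"
  where "freq_dot k t = (\<Sum>i\<in>UNIV. of_int (k $ i) * t $ i)"

definition torus_box :: "(real ^ 'd::finite) set"
  where "torus_box = {t. \<forall>i. - pi < t $ i \<and> t $ i \<le> pi}"

(* A function on the torus is represented by its values on torus_box. *)
definition torus_L2 :: "(real ^ 'd::finite \<Rightarrow> complex) \<Rightarrow> bool"
  where "torus_L2 f \<longleftrightarrow>
    f \<in> borel_measurable (lebesgue_on torus_box) \<and>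
    integrable (lebesgue_on torus_box) (\<lambda>t. (cmod (f t))\<^sup>2)"

(* The expansion is in the characters exp (- i k.t), hence the positive sign in the
   exponent of the coefficient integral. *)
definition fourier_coeff :: "(real ^ 'd::finite \<Rightarrow> complex) \<Rightarrow> int ^ 'd \<Rightarrow> complex"
  where "fourier_coeff f k =
    (LINT t|lebesgue_on torus_box. f t * exp (\<i> * of_real (freq_dot k t)))
      / of_real ((2 * pi) ^ CARD('d))"

(* At the zeros of the denominator, a Lebesgue null set since ar_poly is a nonzero Laurent
   polynomial, the value is 0 by the convention x / 0 = 0. *)
definition arma_quotient ::
    "(int ^ 'd::finite) set \<Rightarrow> (int ^ 'd \<Rightarrow> complex) \<Rightarrow>
     (int ^ 'd) set \<Rightarrow> (int ^ 'd \<Rightarrow> complex) \<Rightarrow> real ^ 'd \<Rightarrow> complex"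
  where "arma_quotient R \<phi> S \<theta> t = ma_poly S \<theta> (exp_neg_i t) / ar_poly R \<phi> (exp_neg_i t)"

definition random_field :: "'a measure \<Rightarrow> ('t \<Rightarrow> 'a \<Rightarrow> complex) \<Rightarrow> bool"
  where "random_field M Y \<longleftrightarrow> (\<forall>t. Y t \<in> borel_measurable M)"

definition iid_field :: "'a measure \<Rightarrow> ('t \<Rightarrow> 'a \<Rightarrow> complex) \<Rightarrow> bool"
  where "iid_field M Z \<longleftrightarrow>
    random_field M Z \<and>
    prob_space.indep_vars M (\<lambda>_. borel) Z UNIV \<and>
    (\<forall>s t. distr M borel (Z s) = distr M borel (Z t))"

(* Existence of a linear solution does not imply square integrability for almost surely constant
   noise: Z = 0 admits the solution Y = 0 whatever the two polynomials are. *)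
definition as_constant :: "'a measure \<Rightarrow> ('a \<Rightarrow> complex) \<Rightarrow> bool"
  where "as_constant M X \<longleftrightarrow> (\<exists>c. AE \<omega> in M. X \<omega> = c)"

definition solves_arma ::
    "'a measure \<Rightarrow> (int ^ 'd::finite) set \<Rightarrow> (int ^ 'd \<Rightarrow> complex) \<Rightarrow>
     (int ^ 'd) set \<Rightarrow> (int ^ 'd \<Rightarrow> complex) \<Rightarrow>
     (int ^ 'd \<Rightarrow> 'a \<Rightarrow> complex) \<Rightarrow> (int ^ 'd \<Rightarrow> 'a \<Rightarrow> complex) \<Rightarrow> bool"
  where "solves_arma M R \<phi> S \<theta> Z Y \<longleftrightarrow>
    (\<forall>t. AE \<omega> in M.
      Y t \<omega> - (\<Sum>n\<in>R. \<phi> n * Y (t - n) \<omega>) = Z t \<omega> + (\<Sum>n\<in>S. \<theta> n * Z (t - n) \<omega>))"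

definition linear_series_conv ::
    "'a measure \<Rightarrow> (int ^ 'd::finite \<Rightarrow> complex) \<Rightarrow> (int ^ 'd \<Rightarrow> 'a \<Rightarrow> complex) \<Rightarrow> bool"
  where "linear_series_conv M \<psi> Z \<longleftrightarrow>
    (\<forall>t. AE \<omega> in M. (\<lambda>k. cmod (\<psi> k * Z (t - k) \<omega>)) summable_on UNIV)"

(* infsum is 0 on the event where the series does not converge. *)
definition linear_field ::
    "(int ^ 'd::finite \<Rightarrow> complex) \<Rightarrow> (int ^ 'd \<Rightarrow> 'a \<Rightarrow> complex) \<Rightarrow> int ^ 'd \<Rightarrow> 'a \<Rightarrow> complex"
  where "linear_field \<psi> Z t \<omega> = (\<Sum>\<^sub>\<infinity>k\<in>UNIV. \<psi> k * Z (t - k) \<omega>)"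

(* Strict stationarity is not a separate clause: it follows from the representation of Y as a
   shift-invariant function of the i.i.d. field Z. *)
definition linear_stationary_solution ::
    "'a measure \<Rightarrow> (int ^ 'd::finite) set \<Rightarrow> (int ^ 'd \<Rightarrow> complex) \<Rightarrow>
     (int ^ 'd) set \<Rightarrow> (int ^ 'd \<Rightarrow> complex) \<Rightarrow>
     (int ^ 'd \<Rightarrow> 'a \<Rightarrow> complex) \<Rightarrow> (int ^ 'd \<Rightarrow> 'a \<Rightarrow> complex) \<Rightarrow> bool"
  where "linear_stationary_solution M R \<phi> S \<theta> Z Y \<longleftrightarrow>
    random_field M Y \<and>
    solves_arma M R \<phi> S \<theta> Z Y \<and>
    (\<exists>\<psi>. linear_series_conv M \<psi> Z \<and> (\<forall>t. AE \<omega> in M. Y t \<omega> = linear_field \<psi> Z t \<omega>))"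

end

theory Submission
  imports Defs
begin

text \<open>
  A linear field with coefficients \<open>\<psi>\<close> solves the ARMA equation as soon as
  \<open>\<psi> k - (\<Sum>n\<in>R. \<phi> n \<psi> (k - n))\<close> is the \<open>k\<close>-th coefficient of \<open>\<Theta>\<close>. The Fourier coefficients of an
  integrable \<open>\<Theta> / \<Phi>\<close> satisfy this recursion because \<open>\<Phi>\<close> vanishes only on a null set. Conversely,
  almost sure absolute convergence with noise that is not almost surely zero forces \<open>\<psi>\<close> to be
  absolutely summable. If some coefficient of the recursion were violated, one noise variable would
  be a function of the others, hence independent of itself, hence constant. So the recursion holds,
  the continuous function \<open>\<Psi>\<close> with coefficients \<open>\<psi>\<close> satisfies \<open>\<Phi> \<Psi> = \<Theta>\<close> pointwise, and \<open>\<Theta> / \<Phi>\<close> agrees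
  almost everywhere with the bounded function \<open>\<Psi>\<close>.
\<close>

section \<open>Characters of the torus\<close>

definition torus_char :: "int ^ 'd::finite \<Rightarrow> real ^ 'd \<Rightarrow> complex"
  where "torus_char k t = exp (- (\<i> * of_real (freq_dot k t)))"

abbreviation torus_measure :: "(real ^ 'd::finite) measure"
  where "torus_measure \<equiv> lebesgue_on torus_box"

lemma freq_dot_add_left: "freq_dot (k + l) t = freq_dot k t + freq_dot l t"
  by (simp add: freq_dot_def distrib_right sum.distrib)

lemma freq_dot_add_right: "freq_dot k (t + u) = freq_dot k t + freq_dot k u"
  by (simp add: freq_dot_def distrib_left sum.distrib)

lemma freq_dot_minus_left: "freq_dot (- k) t = - freq_dot k t"
  by (simp add: freq_dot_def sum_negf)

lemma torus_char_0 [simp]: "torus_char 0 t = 1"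
  by (simp add: torus_char_def freq_dot_def)

lemma torus_char_add: "torus_char (k + l) t = torus_char k t * torus_char l t"
  by (simp add: torus_char_def freq_dot_add_left exp_add[symmetric] algebra_simps)

lemma exp_freq_dot: "exp (\<i> * of_real (freq_dot k t)) = torus_char (- k) t"
  by (simp add: torus_char_def freq_dot_minus_left)

lemma norm_torus_char [simp]: "cmod (torus_char k t) = 1"
  by (simp add: torus_char_def)

lemma torus_char_prod: "torus_char k t = (\<Prod>i\<in>UNIV. exp (- (\<i> * of_real (of_int (k $ i) * t $ i))))"
  by (simp add: torus_char_def freq_dot_def exp_sum[symmetric] sum_distrib_left sum_negf)

lemma multi_power_exp_neg_i: "multi_power (exp_neg_i t) k = torus_char k t"
  unfolding multi_power_def exp_neg_i_def torus_char_prod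
  by (intro prod.cong refl) (simp add: exp_power_int mult_ac)

lemma ar_poly_torus: "ar_poly R \<phi> (exp_neg_i t) = 1 - (\<Sum>n\<in>R. \<phi> n * torus_char n t)"
  by (simp add: ar_poly_def multi_power_exp_neg_i)

lemma ma_poly_torus: "ma_poly S \<theta> (exp_neg_i t) = 1 + (\<Sum>n\<in>S. \<theta> n * torus_char n t)"
  by (simp add: ma_poly_def multi_power_exp_neg_i)

lemma continuous_on_torus_char [continuous_intros]: "continuous_on A (torus_char k)"
  unfolding torus_char_def freq_dot_def by (intro continuous_intros)

lemma borel_measurable_torus_char [measurable]: "torus_char k \<in> borel_measurable borel"
  by (intro borel_measurable_continuous_onI continuous_intros)

lemma borel_measurable_ar_poly [measurable]:
  "(\<lambda>t. ar_poly R \<phi> (exp_neg_i t)) \<in> borel_measurable borel"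
  unfolding ar_poly_torus by measurable

lemma borel_measurable_arma_quotient [measurable]: "arma_quotient R \<phi> S \<theta> \<in> borel_measurable borel"
  unfolding arma_quotient_def ma_poly_torus ar_poly_torus by measurable

section \<open>The torus as a finite measure space\<close>

lemma torus_box_sets [measurable, simp]: "(torus_box :: (real ^ 'd::finite) set) \<in> sets borel"
proof -
  have "torus_box = {t :: real ^ 'd. \<forall>i. - pi < t $ i} \<inter> {t. \<forall>i. t $ i \<le> pi}"
    by (auto simp: torus_box_def)
  moreover have "open {t::real ^ 'd. \<forall>i. - pi < t $ i}"
    unfolding Collect_all_eq by (intro open_INT ballI open_Collect_less continuous_intros) auto
  moreover have "closed {t::real ^ 'd. \<forall>i. t $ i \<le> pi}"
    by (intro closed_Collect_all closed_Collect_le continuous_intros)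
  ultimately show ?thesis
    by (metis borel_closed borel_open sets.Int)
qed

lemma torus_box_lmeasurable: "(torus_box :: (real ^ 'd::finite) set) \<in> lmeasurable"
proof (rule bounded_set_imp_lmeasurable)
  show "bounded (torus_box :: (real ^ 'd) set)"
    by (rule bounded_subset[OF bounded_cbox[of "\<chi> i. - pi" "\<chi> i. pi"]])
       (auto simp: torus_box_def mem_box_cart less_imp_le)
  show "torus_box \<in> sets (lebesgue :: (real ^ 'd) measure)"
    using torus_box_sets by auto
qed

lemma finite_measure_torus: "finite_measure torus_measure"
  by (intro finite_measure_lebesgue_on torus_box_lmeasurable)

lemma borel_imp_torus_measurable: "f \<in> borel_measurable borel \<Longrightarrow> f \<in> borel_measurable torus_measure"
  by (intro measurable_restrict_space1 measurable_completion) simp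

lemma integral_torus_eq_lborel:
  fixes f :: "real ^ 'd::finite \<Rightarrow> complex"
  assumes [measurable]: "f \<in> borel_measurable borel"
  shows "(LINT t|torus_measure. f t) = (LINT t|lborel. indicator torus_box t *\<^sub>R f t)"
proof -
  have "(LINT t|torus_measure. f t) = (LINT t|lebesgue. indicator torus_box t *\<^sub>R f t)"
    by (rule integral_restrict_space) simp
  also have "\<dots> = (LINT t|lborel. indicator torus_box t *\<^sub>R f t)"
    by (rule integral_completion) simp
  finally show ?thesis .
qed

section \<open>Orthogonality of the characters\<close>

lemma mem_torus_box_iff: "t \<in> torus_box \<longleftrightarrow> (\<forall>b\<in>Basis. t \<bullet> b \<in> {- pi<..pi})"
  by (auto simp: torus_box_def Basis_vec_def inner_axis)

lemma freq_dot_eq_inner: "freq_dot k t = (\<Sum>b\<in>Basis. ((\<chi> i. of_int (k $ i)) \<bullet> b) * (t \<bullet> b))"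
proof -
  have "freq_dot k t = (\<chi> i. of_int (k $ i)) \<bullet> t"
    by (simp add: freq_dot_def inner_vec_def)
  then show ?thesis
    by (simp only: euclidean_inner [of _ t])
qed

text \<open>For an integer \<open>w\<close> other than 0 the antiderivative is
  \<open>2 * pi\<close>-periodic, so its values at the two endpoints cancel.\<close>

lemma integral_exp_interval:
  fixes w :: real
  assumes "w \<in> \<int>"
  shows "(LINT x|lborel. indicator {- pi<..pi} x *\<^sub>R exp (- (\<i> * of_real (w * x)))) =
           (if w = 0 then of_real (2 * pi) else 0)"
    (is "?I = _")
proof -
  \<comment> \<open>The fundamental theorem needs the closed interval; the added endpoint is a null
    set.\<close>
  have "?I = (LINT x|lborel. indicator {- pi..pi} x *\<^sub>R exp (- (\<i> * of_real (w * x))))"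
    using AE_lborel_singleton [of "- pi"]
    by (intro integral_cong_AE) (auto elim!: eventually_mono simp: indicator_def)
  also have "\<dots> = (if w = 0 then of_real (2 * pi) else 0)"
  proof (cases "w = 0")
    case True
    then show ?thesis
      using integral_FTC_Icc [of "- pi" pi "\<lambda>x. of_real x" "\<lambda>x. 1 :: complex"]
      by (auto intro!: derivative_eq_intros simp: scaleR_conv_of_real)
  next
    case False
    define F :: "real \<Rightarrow> complex" where "F x = \<i> / of_real w * exp (- (\<i> * of_real (w * x)))" for x
    have ftc: "(LINT x|lborel. indicator {- pi..pi} x *\<^sub>R exp (- (\<i> * of_real (w * x)))) = F pi - F (- pi)"
    proof (rule integral_FTC_Icc)
      fix x
      have "((\<lambda>z. \<i> / of_real w * exp (- (\<i> * (of_real w * z)))) has_field_derivative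
              exp (- (\<i> * of_real (w * x)))) (at (of_real x))"
        using False by (auto intro!: derivative_eq_intros simp: field_simps)
      from has_vector_derivative_real_field [OF this]
      show "(F has_vector_derivative exp (- (\<i> * of_real (w * x)))) (at x within {- pi..pi})"
        by (simp add: F_def [abs_def])
    qed (auto intro!: continuous_intros)
    obtain n where n: "w = of_int n"
      using assms by (auto elim: Ints_cases)
    have "exp (\<i> * of_real (w * pi)) = exp (- (\<i> * of_real (w * pi)) + (2 * of_int n * pi) * \<i>)"
      by (simp add: n algebra_simps)
    also have "\<dots> = exp (- (\<i> * of_real (w * pi)))"
      by (subst exp_add, subst exp_integer_2pi) auto
    finally have "F pi - F (- pi) = 0"
      by (simp add: F_def)
    with ftc show ?thesis
      using False by simp
  qed
  finally show ?thesis .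
qed

text \<open>Character and box indicator both factor over the coordinates, so the integral is a
  product of one-dimensional ones, and a single nonzero coordinate of \<open>k\<close> makes it
  vanish.\<close>

lemma integral_torus_char:
  "(LINT t|torus_measure. torus_char k (t :: real ^ 'd::finite)) =
     (if k = 0 then of_real ((2 * pi) ^ CARD('d)) else 0)"
proof -
  define g :: "real \<Rightarrow> real \<Rightarrow> complex"
    where "g w x = indicator {- pi<..pi} x *\<^sub>R exp (- (\<i> * of_real (w * x)))" for w x
  define v :: "real ^ 'd" where "v = (\<chi> i. of_int (k $ i))"
  have g_meas [measurable]: "g w \<in> borel_measurable borel" for w
    unfolding g_def by measurable
  have g_int: "integrable lborel (g w)" for w
  proof (rule integrableI_bounded)
    have "(\<integral>\<^sup>+ x. ennreal (norm (g w x)) \<partial>lborel) \<le> (\<integral>\<^sup>+ x. indicator {- pi<..pi} x \<partial>lborel)"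
      by (intro nn_integral_mono) (auto simp: g_def indicator_def)
    also have "\<dots> < \<infinity>" by simp
    finally show "(\<integral>\<^sup>+ x. ennreal (norm (g w x)) \<partial>lborel) < \<infinity>" .
  qed simp
  have v_int: "v \<bullet> b \<in> \<int>" if "b \<in> Basis" for b
    using that by (auto simp: v_def Basis_vec_def inner_axis)
  have v_0: "(\<forall>b\<in>Basis. v \<bullet> b = 0) \<longleftrightarrow> k = 0"
    by (auto simp: v_def Basis_vec_def inner_axis vec_eq_iff)
  interpret product_sigma_finite "\<lambda>b :: real ^ 'd. lborel :: real measure"
    by standard
  have "indicator torus_box t *\<^sub>R torus_char k t = (\<Prod>b\<in>Basis. g (v \<bullet> b) (t \<bullet> b))" for t
  proof (cases "t \<in> torus_box")
    case True
    then have "(\<Prod>b\<in>Basis. g (v \<bullet> b) (t \<bullet> b)) = (\<Prod>b\<in>Basis. exp (- (\<i> * of_real ((v \<bullet> b) * (t \<bullet> b)))))"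
      by (intro prod.cong) (auto simp: g_def mem_torus_box_iff)
    then show ?thesis
      using True by (simp add: torus_char_def freq_dot_eq_inner v_def exp_sum [symmetric] sum_distrib_left sum_negf)
  next
    case False
    then obtain b where "b \<in> Basis" "t \<bullet> b \<notin> {- pi<..pi}"
      unfolding mem_torus_box_iff by auto
    then have "(\<Prod>b\<in>Basis. g (v \<bullet> b) (t \<bullet> b)) = 0"
      by (intro prod_zero bexI [of _ b]) (auto simp: g_def)
    then show ?thesis
      using False by simp
  qed
  then have "(LINT t|torus_measure. torus_char k t) = (LINT t|lborel. (\<Prod>b\<in>Basis. g (v \<bullet> b) (t \<bullet> b)))"
    by (subst integral_torus_eq_lborel) auto
  \<comment> \<open>\<open>lborel\<close> on a Euclidean space is the image of the product of
    one-dimensional Lebesgue measures under the map from coordinates to vectors.\<close>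
  also have "\<dots> = (LINT f|(\<Pi>\<^sub>M b\<in>Basis. lborel). (\<Prod>b\<in>Basis. g (v \<bullet> b) ((\<Sum>c\<in>Basis. f c *\<^sub>R c) \<bullet> b)))"
    by (subst lborel_eq, subst integral_distr) auto
  also have "\<dots> = (LINT f|(\<Pi>\<^sub>M b\<in>Basis. lborel). (\<Prod>b\<in>(Basis :: (real ^ 'd) set). g (v \<bullet> b) (f b)))"
    by (intro Bochner_Integration.integral_cong prod.cong) auto
  also have "\<dots> = (\<Prod>b\<in>(Basis :: (real ^ 'd) set). integral\<^sup>L lborel (g (v \<bullet> b)))"
    by (intro product_integral_prod g_int) auto
  also have "\<dots> = (\<Prod>b\<in>(Basis :: (real ^ 'd) set). if v \<bullet> b = 0 then of_real (2 * pi) else 0)"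
    unfolding g_def using v_int by (intro prod.cong integral_exp_interval) auto
  also have "\<dots> = (if k = 0 then of_real ((2 * pi) ^ CARD('d)) else 0)"
    unfolding v_0 [symmetric] by (auto simp: prod_zero_iff)
  finally show ?thesis .
qed

section \<open>The zero set of the autoregressive polynomial\<close>

text \<open>Take \<open>m\<close> on the moment curve, with entries \<open>x ^ f i\<close>. Its
  product with \<open>n\<close> is the value at \<open>x\<close> of the nonzero polynomial with
  coefficients \<open>n $ i\<close>; finitely many polynomials have finitely many roots, so some
  integer \<open>x\<close> avoids them all.\<close>

lemma exists_nonorthogonal_int_vector:
  fixes R :: "(int ^ 'd::finite) set"
  assumes "finite R" "0 \<notin> R"
  obtains m :: "int ^ 'd" where "\<And>n. n \<in> R \<Longrightarrow> (\<Sum>i\<in>UNIV. n $ i * m $ i) \<noteq> 0"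
proof -
  obtain f :: "'d \<Rightarrow> nat" where f: "inj f"
    using finite_imp_inj_to_nat_seg [of "UNIV :: 'd set"] by auto
  define p :: "int ^ 'd \<Rightarrow> int poly" where "p n = (\<Sum>i\<in>UNIV. monom (n $ i) (f i))" for n
  have "coeff (p n) (f i) = n $ i" for n i
    using f by (simp add: p_def coeff_sum inj_eq)
  then have "p n \<noteq> 0" if "n \<in> R" for n
    using that assms(2) by (metis coeff_0 vec_eq_iff zero_index)
  then have "finite (\<Union>n\<in>R. {x. poly (p n) x = 0})"
    using assms(1) by (auto intro: poly_roots_finite)
  then obtain x where "x \<notin> (\<Union>n\<in>R. {x. poly (p n) x = 0})"
    using ex_new_if_finite [OF infinite_UNIV_int] by metis
  then show thesis
    by (intro that [of "\<chi> i. x ^ f i"]) (auto simp: p_def poly_sum poly_monom)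
qed

text \<open>The preimage is empty or a coset of the integer multiples of
  \<open>2 * pi\<close>.\<close>

lemma countable_exp_preimage: "countable {s :: real. exp (- (\<i> * of_real s)) = w}"
proof (cases "\<exists>s. exp (- (\<i> * of_real s)) = w")
  case True
  then obtain s where s: "exp (- (\<i> * of_real s)) = w" by auto
  have "{s. exp (- (\<i> * of_real s)) = w} \<subseteq> range (\<lambda>n :: int. s - 2 * pi * n)"
  proof safe
    fix u :: real assume "w = exp (- (\<i> * of_real u))"
    with s obtain n :: int where "- (\<i> * of_real u) = - (\<i> * of_real s) + (of_int (2 * n) * pi) * \<i>"
      by (metis exp_eq)
    then have "u = s - 2 * pi * n"
      by (simp add: complex_eq_iff algebra_simps)
    then show "u \<in> range (\<lambda>n :: int. s - 2 * pi * n)" by auto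
  qed
  then show ?thesis
    by (rule countable_subset) auto
qed auto

text \<open>
  Along a line in an integer direction \<open>m\<close> with \<open>n \<cdot> m \<noteq> 0\<close> for all \<open>n \<in> R\<close> the polynomial becomes a
  one-variable Laurent polynomial with constant term 1, which has countably many zeros. Fubini and
  translation invariance then transfer this to the whole space.
\<close>

lemma countable_ar_poly_zeros_on_line:
  fixes R :: "(int ^ 'd::finite) set"
  assumes R: "finite R" and m: "\<And>n. n \<in> R \<Longrightarrow> (\<Sum>i\<in>UNIV. n $ i * m $ i) \<noteq> 0"
  shows "countable {s. ar_poly R \<phi> (exp_neg_i (t + s *\<^sub>R (\<chi> i. of_int (m $ i)))) = 0}"
proof -
  define a where "a n = (\<Sum>i\<in>UNIV. n $ i * m $ i)" for n :: "int ^ 'd"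
  \<comment> \<open>Multiplying by the power \<open>K\<close> clears all negative exponents of the
    Laurent polynomial.\<close>
  define K where "K = (\<Sum>n\<in>R. nat \<bar>a n\<bar>)"
  have K: "int K + a n \<ge> 0" if "n \<in> R" for n
  proof -
    have "nat \<bar>a n\<bar> \<le> K"
      unfolding K_def using R that by (intro member_le_sum) auto
    then show ?thesis by linarith
  qed
  define p :: "complex poly"
    where "p = monom 1 K - (\<Sum>n\<in>R. monom (\<phi> n * torus_char n t) (nat (int K + a n)))"
  \<comment> \<open>Since \<open>a n\<close> is never 0, no term of the sum has degree
    \<open>K\<close>; the constant term 1, shifted to degree \<open>K\<close>, therefore survives
    and \<open>p\<close> is nonzero.\<close>
  have "(\<Sum>n\<in>R. coeff (monom (\<phi> n * torus_char n t) (nat (int K + a n))) K) = 0"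
    using K m by (intro sum.neutral) (force simp: a_def)
  then have "coeff p K = 1"
    by (simp add: p_def coeff_sum)
  then have "finite {w. poly p w = 0}"
    by (intro poly_roots_finite) auto
  then have "countable (\<Union>w\<in>{w. poly p w = 0}. {s :: real. exp (- (\<i> * of_real s)) = w})"
    by (intro countable_UN countable_exp_preimage countable_finite)
  moreover have "{s. ar_poly R \<phi> (exp_neg_i (t + s *\<^sub>R (\<chi> i. of_int (m $ i)))) = 0} \<subseteq>
      (\<Union>w\<in>{w. poly p w = 0}. {s :: real. exp (- (\<i> * of_real s)) = w})"
  proof safe
    fix s assume s: "ar_poly R \<phi> (exp_neg_i (t + s *\<^sub>R (\<chi> i. of_int (m $ i)))) = 0"
    define w where "w = exp (- (\<i> * of_real s))"
    have "torus_char n (t + s *\<^sub>R (\<chi> i. of_int (m $ i))) = torus_char n t * w powi a n" for n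
    proof -
      have "freq_dot n (s *\<^sub>R (\<chi> i. of_int (m $ i))) = of_int (a n) * s"
        by (simp add: freq_dot_def a_def sum_distrib_right sum_distrib_left mult_ac)
      then show ?thesis
        by (simp add: torus_char_def freq_dot_add_right w_def exp_power_int exp_add [symmetric] algebra_simps)
    qed
    then have "(\<Sum>n\<in>R. \<phi> n * torus_char n t * w powi a n) = 1"
      using s by (simp add: ar_poly_torus mult.assoc)
    moreover have "(\<Sum>n\<in>R. \<phi> n * torus_char n t * w ^ nat (int K + a n)) =
        w ^ K * (\<Sum>n\<in>R. \<phi> n * torus_char n t * w powi a n)"
      unfolding sum_distrib_left
    proof (intro sum.cong refl)
      fix n assume "n \<in> R"
      then have "w ^ nat (int K + a n) = w ^ K * w powi a n"
        using K [of n] by (simp add: w_def power_int_add [symmetric] flip: power_int_of_nat)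
      then show "\<phi> n * torus_char n t * w ^ nat (int K + a n) =
          w ^ K * (\<phi> n * torus_char n t * w powi a n)"
        by (simp only: mult.left_commute)
    qed
    ultimately have "poly p w = 0"
      by (simp add: p_def poly_sum poly_monom)
    then show "s \<in> (\<Union>w\<in>{w. poly p w = 0}. {s. exp (- (\<i> * of_real s)) = w})"
      by (auto simp: w_def)
  qed
  ultimately show ?thesis
    by (rule countable_subset [rotated])
qed

lemma AE_ar_poly_nonzero:
  fixes R :: "(int ^ 'd::finite) set"
  assumes "finite R" "0 \<notin> R"
  shows "AE t in torus_measure. ar_poly R \<phi> (exp_neg_i t) \<noteq> 0"
proof -
  obtain m :: "int ^ 'd" where m: "\<And>n. n \<in> R \<Longrightarrow> (\<Sum>i\<in>UNIV. n $ i * m $ i) \<noteq> 0"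
    using exists_nonorthogonal_int_vector assms by metis
  define v :: "real ^ 'd" where "v = (\<chi> i. of_int (m $ i))"
  have "AE s in lborel. ar_poly R \<phi> (exp_neg_i (t + s *\<^sub>R v)) \<noteq> 0" for t
    using countable_imp_null_set_lborel [OF countable_ar_poly_zeros_on_line [OF assms(1) m, of \<phi> t]]
    by (intro AE_I' [where N = "{s. ar_poly R \<phi> (exp_neg_i (t + s *\<^sub>R v)) = 0}"]) (auto simp: v_def)
  then have "AE t in lborel. AE s in lborel. ar_poly R \<phi> (exp_neg_i (t + s *\<^sub>R v)) \<noteq> 0"
    by simp
  then have "AE s in lborel. AE t in lborel. ar_poly R \<phi> (exp_neg_i (t + s *\<^sub>R v)) \<noteq> 0"
    by (subst (asm) lborel_pair.AE_commute) measurable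
  \<comment> \<open>Lebesgue measure on the line is not zero, so a property of almost every
    \<open>s\<close> holds for some \<open>s\<close>. One suffices, because translation by
    \<open>s *\<^sub>R v\<close> preserves the measure.\<close>
  then have "\<exists>s. AE t in lborel. ar_poly R \<phi> (exp_neg_i (t + s *\<^sub>R v)) \<noteq> 0"
    using eventually_happens' [of "ae_filter (lborel :: real measure)"]
    by (auto simp: ae_filter_eq_bot_iff)
  then obtain s where "AE t in lborel. ar_poly R \<phi> (exp_neg_i (s *\<^sub>R v + t)) \<noteq> 0"
    by (auto simp: add.commute)
  then have "AE t in distr lborel borel ((+) (s *\<^sub>R v)). ar_poly R \<phi> (exp_neg_i t) \<noteq> 0"
    by (subst AE_distr_iff) auto
  then have "AE t in lborel. ar_poly R \<phi> (exp_neg_i t) \<noteq> 0"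
    by (subst (asm) lborel_distr_plus)
  then have "AE t in lebesgue. ar_poly R \<phi> (exp_neg_i t) \<noteq> 0"
    by (rule AE_completion)
  then show ?thesis
    by (subst AE_restrict_space_iff) auto
qed

section \<open>Infinite sums and the coefficient recursion\<close>

text \<open>Both sides default to 0: \<open>infsum\<close> if the family is not summable, the
  integral if it is not absolutely summable. The assumption makes the two cases coincide, so the
  equation holds even under divergence.\<close>

lemma infsum_eq_integral_count_space:
  fixes f :: "'i \<Rightarrow> 'b::{banach,second_countable_topology}"
  assumes "f summable_on A \<Longrightarrow> (\<lambda>i. norm (f i)) summable_on A"
  shows "infsum f A = integral\<^sup>L (count_space A) f"
proof (cases "f summable_on A")
  case True
  then have "Infinite_Set_Sum.abs_summable_on f A"
    using assms by (simp add: abs_summable_equivalent [symmetric])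
  then show ?thesis
    by (simp add: infsetsum_infsum [symmetric] infsetsum_def)
next
  case False
  then have "\<not> Infinite_Set_Sum.abs_summable_on f A"
    using abs_summable_summable [of f A] by (auto simp: abs_summable_equivalent [symmetric])
  with False show ?thesis
    by (simp add: infsum_not_exists Infinite_Set_Sum.abs_summable_on_def not_integrable_integral_eq)
qed

text \<open>The sum is a parametrised integral over a countable counting measure, hence measurable
  also across the points of divergence.\<close>

lemma borel_measurable_infsum:
  fixes f :: "'i::countable \<Rightarrow> 'a \<Rightarrow> 'b::{banach,second_countable_topology}"
  assumes "\<And>i. i \<in> A \<Longrightarrow> f i \<in> borel_measurable M"
    and "\<And>x. (\<lambda>i. f i x) summable_on A \<Longrightarrow> (\<lambda>i. norm (f i x)) summable_on A"
  shows "(\<lambda>x. \<Sum>\<^sub>\<infinity>i\<in>A. f i x) \<in> borel_measurable M"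
proof -
  interpret sigma_finite_measure "count_space A"
    by (rule sigma_finite_measure_count_space_countable) simp
  have "(\<lambda>(i, x). f i x) \<in> borel_measurable (count_space A \<Otimes>\<^sub>M M)"
    using assms(1) by (intro measurable_pair_measure_countable1) auto
  then have "(\<lambda>(x, i). f i x) \<in> borel_measurable (M \<Otimes>\<^sub>M count_space A)"
    by (subst (asm) measurable_pair_swap_iff) (simp add: case_prod_unfold)
  then have "(\<lambda>x. integral\<^sup>L (count_space A) (\<lambda>i. f i x)) \<in> borel_measurable M"
    by (rule borel_measurable_lebesgue_integral)
  then show ?thesis
    by (subst infsum_eq_integral_count_space [OF assms(2)])
qed

lemma borel_measurable_infsum_complex:
  fixes f :: "'i::countable \<Rightarrow> 'a \<Rightarrow> complex"
  assumes "\<And>i. i \<in> A \<Longrightarrow> f i \<in> borel_measurable M"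
  shows "(\<lambda>x. \<Sum>\<^sub>\<infinity>i\<in>A. f i x) \<in> borel_measurable M"
  using assms by (rule borel_measurable_infsum) (simp_all add: summable_on_iff_abs_summable_on_complex)

text \<open>The coefficient at \<open>k\<close> of \<Phi> \<Psi> - \<Theta>, where \<Psi> has
  coefficients \<open>\<psi>\<close>. The \<open>of_bool\<close> terms are the coefficients of
  \<Theta>; in this form each piece can be summed separately against a weight.\<close>

definition arma_residual ::
    "(int ^ 'd::finite) set \<Rightarrow> (int ^ 'd \<Rightarrow> complex) \<Rightarrow> (int ^ 'd) set \<Rightarrow> (int ^ 'd \<Rightarrow> complex) \<Rightarrow>
     (int ^ 'd \<Rightarrow> complex) \<Rightarrow> int ^ 'd \<Rightarrow> complex"
  where "arma_residual R \<phi> S \<theta> \<psi> k =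
    (\<psi> k - (\<Sum>n\<in>R. \<phi> n * \<psi> (k - n))) - (of_bool (k = 0) + (\<Sum>n\<in>S. \<theta> n * of_bool (k = n)))"

lemma has_sum_sum:
  fixes f :: "'i \<Rightarrow> 'j \<Rightarrow> 'b::topological_comm_monoid_add"
  assumes "finite I" "\<And>i. i \<in> I \<Longrightarrow> (f i has_sum s i) A"
  shows "((\<lambda>j. \<Sum>i\<in>I. f i j) has_sum (\<Sum>i\<in>I. s i)) A"
  using assms by (induction I rule: finite_induct) (auto intro!: has_sum_add)

lemma has_sum_of_bool_mult:
  fixes w :: "'i \<Rightarrow> complex"
  shows "((\<lambda>k. of_bool (k = n) * w k) has_sum w n) UNIV"
proof -
  have "((\<lambda>k. of_bool (k = n) * w k) has_sum w n) {n}"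
    by (rule has_sum_finiteI) auto
  then show ?thesis
    by (rule has_sum_cong_neutral [THEN iffD1, rotated -1]) auto
qed

text \<open>
  With \<open>w k = exp (- i k \<cdot> t)\<close> the conclusion compares \<open>\<Phi> \<Psi>\<close> with \<open>\<Theta>\<close>; with \<open>w k = Z (t - k)\<close>
  it compares the two sides of the ARMA equation.
\<close>

lemma has_sum_arma_residual:
  fixes w :: "int ^ 'd::finite \<Rightarrow> complex"
  assumes "finite R" "finite S"
    and y: "\<And>n. n \<in> insert 0 R \<Longrightarrow> ((\<lambda>k. \<psi> k * w (k + n)) has_sum y n) UNIV"
  shows "((\<lambda>k. arma_residual R \<phi> S \<theta> \<psi> k * w k) has_sum
            ((y 0 - (\<Sum>n\<in>R. \<phi> n * y n)) - (w 0 + (\<Sum>n\<in>S. \<theta> n * w n)))) UNIV"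
proof -
  \<comment> \<open>Reindexing by \<open>k + n\<close> moves the lag from the weight to the
    coefficients, where the residual has it.\<close>
  have shift: "((\<lambda>k. \<psi> (k - n) * w k) has_sum y n) UNIV" if "n \<in> R" for n
  proof -
    have "bij_betw (\<lambda>k. k + n) UNIV (UNIV :: (int ^ 'd) set)"
      by (rule bij_betwI [where g = "\<lambda>k. k - n"]) auto
    from has_sum_reindex_bij_betw [OF this, of "\<lambda>k. \<psi> (k - n) * w k" "y n"] y that
    show ?thesis by simp
  qed
  have "((\<lambda>k. (\<psi> k * w k + (\<Sum>n\<in>R. - \<phi> n * (\<psi> (k - n) * w k))) +
          (- 1 * (of_bool (k = 0) * w k) + (\<Sum>n\<in>S. - \<theta> n * (of_bool (k = n) * w k)))) has_sum
        ((y 0 + (\<Sum>n\<in>R. - \<phi> n * y n)) + (- 1 * w 0 + (\<Sum>n\<in>S. - \<theta> n * w n)))) UNIV"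
    using y [of 0] assms(1,2)
    by (intro has_sum_add has_sum_sum has_sum_cmult_right shift has_sum_of_bool_mult) auto
  then show ?thesis
    by (simp add: arma_residual_def algebra_simps sum_distrib_left sum_negf)
qed

section \<open>Fourier coefficients\<close>

lemma fourier_coeff_torus_char:
  "fourier_coeff f k = (LINT t|torus_measure. f t * torus_char (- k) t) / of_real ((2 * pi) ^ CARD('d))"
  for f :: "real ^ 'd::finite \<Rightarrow> complex"
  by (simp add: fourier_coeff_def exp_freq_dot)

lemma integrable_torus_char_mult:
  assumes "integrable torus_measure f"
  shows "integrable torus_measure (\<lambda>t. f t * torus_char k t)"
proof (rule Bochner_Integration.integrable_bound [OF assms])
  show "(\<lambda>t. f t * torus_char k t) \<in> borel_measurable torus_measure"
    by (intro borel_measurable_times borel_measurable_integrable assms borel_imp_torus_measurable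
        borel_measurable_torus_char)
qed (simp add: norm_mult)

lemma integrable_torus_char: "integrable torus_measure (torus_char k)"
proof -
  interpret finite_measure "torus_measure :: (real ^ 'a) measure" by (rule finite_measure_torus)
  show ?thesis
    by (rule integrable_const_bound [where B = 1]) (auto intro: borel_imp_torus_measurable)
qed

text \<open>The torus has finite measure. Integrability makes the Fourier coefficients genuine
  integrals rather than the default value 0.\<close>

lemma torus_L2_imp_integrable:
  assumes "torus_L2 f"
  shows "integrable torus_measure f"
proof -
  interpret finite_measure "torus_measure :: (real ^ 'a) measure" by (rule finite_measure_torus)
  show ?thesis
  proof (rule Bochner_Integration.integrable_bound)
    show "integrable torus_measure (\<lambda>t. 1 + (cmod (f t))\<^sup>2)"
      using assms by (simp add: torus_L2_def)
    show "f \<in> borel_measurable torus_measure"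
      using assms by (simp add: torus_L2_def)
    \<comment> \<open>Expanding the square of \<open>x - 1 / 2\<close> gives
      \<open>x \<le> x\<^sup>2 + 1 / 4\<close>.\<close>
    have "x \<le> 1 + x\<^sup>2" for x :: real
      using zero_le_power2 [of "x - 1 / 2"] by (simp add: power2_eq_square algebra_simps)
    then show "AE t in torus_measure. norm (f t) \<le> norm (1 + (cmod (f t))\<^sup>2)"
      by (auto intro!: AE_I2)
  qed
qed

text \<open>Absolute summability lets sum and integral be exchanged, and orthogonality leaves only
  the term of index \<open>k\<close>.\<close>

lemma fourier_coeff_eq_if_series:
  fixes f :: "real ^ 'd::finite \<Rightarrow> complex"
  assumes summable: "(\<lambda>k. cmod (\<psi> k)) summable_on UNIV"
    and [measurable]: "f \<in> borel_measurable borel"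
    and eq: "AE t in torus_measure. f t = (\<Sum>\<^sub>\<infinity>k. \<psi> k * torus_char k t)"
  shows "fourier_coeff f = \<psi>"
proof
  fix k
  define V where "V = complex_of_real ((2 * pi) ^ CARD('d))"
  \<comment> \<open>Term \<open>j\<close> of the series times the character of index
    \<open>- k\<close>. Its modulus does not depend on \<open>t\<close>, which gives the joint
    integrability for Fubini.\<close>
  define h where "h j t = \<psi> j * torus_char (j - k) t" for j and t :: "real ^ 'd"
  interpret T: finite_measure "torus_measure :: (real ^ 'd) measure"
    by (rule finite_measure_torus)
  interpret C: sigma_finite_measure "count_space (UNIV :: (int ^ 'd) set)"
    by (rule sigma_finite_measure_count_space_countable) simp
  interpret pair_sigma_finite "count_space (UNIV :: (int ^ 'd) set)" "torus_measure :: (real ^ 'd) measure" ..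
  have h_meas: "h j \<in> borel_measurable borel" for j
    unfolding h_def by measurable
  have norm_h: "cmod (h j t) = cmod (\<psi> j)" for j t
    by (simp add: h_def norm_mult)
  have abs: "Infinite_Set_Sum.abs_summable_on \<psi> UNIV"
    using summable by (simp add: abs_summable_equivalent)
  have "integrable (count_space UNIV \<Otimes>\<^sub>M torus_measure) (case_prod h)"
  proof (rule Fubini_integrable)
    show "case_prod h \<in> borel_measurable (count_space UNIV \<Otimes>\<^sub>M torus_measure)"
      by (intro measurable_pair_measure_countable1) (auto intro: borel_imp_torus_measurable h_meas)
    show "integrable (count_space UNIV) (\<lambda>j. LINT t|torus_measure. norm (case (j, t) of (j, t) \<Rightarrow> h j t))"
      using abs by (simp add: norm_h Infinite_Set_Sum.abs_summable_on_def integrable_norm)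
    show "AE j in count_space UNIV. integrable torus_measure (\<lambda>t. case (j, t) of (j, t) \<Rightarrow> h j t)"
      by (auto simp: h_def intro!: integrable_torus_char)
  qed
  then have fubini: "(LINT t|torus_measure. LINT j|count_space UNIV. h j t) = (LINT j|count_space UNIV. LINT t|torus_measure. h j t)"
    by (rule Fubini_integral)
  have "(LINT t|torus_measure. f t * torus_char (- k) t) = (LINT t|torus_measure. (\<Sum>\<^sub>\<infinity>j. h j t))"
  proof (rule integral_cong_AE)
    show "(\<lambda>t. f t * torus_char (- k) t) \<in> borel_measurable torus_measure"
      by (rule borel_imp_torus_measurable) measurable
    show "(\<lambda>t. \<Sum>\<^sub>\<infinity>j. h j t) \<in> borel_measurable torus_measure"
      by (intro borel_imp_torus_measurable borel_measurable_infsum_complex h_meas)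
    show "AE t in torus_measure. f t * torus_char (- k) t = (\<Sum>\<^sub>\<infinity>j. h j t)"
      using eq
    proof eventually_elim
      case (elim t)
      have "h j t = \<psi> j * torus_char j t * torus_char (- k) t" for j
        using torus_char_add [of j "- k" t] by (simp add: h_def mult.assoc)
      then show ?case
        by (simp add: elim infsum_cmult_left')
    qed
  qed
  also have "\<dots> = (LINT t|torus_measure. LINT j|count_space UNIV. h j t)"
    by (subst infsum_eq_integral_count_space) (simp_all add: summable_on_iff_abs_summable_on_complex)
  also have "\<dots> = (LINT j|count_space UNIV. LINT t|torus_measure. h j t)"
    by (rule fubini)
  also have "\<dots> = (LINT j|count_space UNIV. of_bool (j = k) * (\<psi> j * V))"
    by (intro Bochner_Integration.integral_cong) (auto simp: h_def integral_torus_char V_def)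
  also have "\<dots> = (\<Sum>\<^sub>\<infinity>j. of_bool (j = k) * (\<psi> j * V))"
    by (subst infsum_eq_integral_count_space) (simp_all add: summable_on_iff_abs_summable_on_complex)
  also have "\<dots> = \<psi> k * V"
    by (rule infsumI [OF has_sum_of_bool_mult])
  finally show "fourier_coeff f k = \<psi> k"
    by (simp add: fourier_coeff_torus_char V_def)
qed

text \<open>Clear the denominator, multiply by the character of index \<open>- k\<close> and
  integrate: each factor \<open>torus_char n\<close> shifts the index of the Fourier coefficient by
  \<open>n\<close>.\<close>

lemma arma_residual_fourier_coeff:
  fixes R S :: "(int ^ 'd::finite) set"
  assumes "finite R" "0 \<notin> R" "finite S" and L2: "torus_L2 (arma_quotient R \<phi> S \<theta>)"
  shows "arma_residual R \<phi> S \<theta> (fourier_coeff (arma_quotient R \<phi> S \<theta>)) k = 0"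
proof -
  define q where "q = arma_quotient R \<phi> S \<theta>"
  define V where "V = complex_of_real ((2 * pi) ^ CARD('d))"
  have V: "V \<noteq> 0" by (simp add: V_def)
  have int_q: "integrable torus_measure q"
    unfolding q_def by (rule torus_L2_imp_integrable [OF L2])
  have q_meas [measurable]: "q \<in> borel_measurable borel"
    by (simp add: q_def)
  have char_shift: "torus_char n t * torus_char (- k) t = torus_char (n - k) t" for n t
    using torus_char_add [of n "- k" t] by simp
  have coeff: "(LINT t|torus_measure. q t * torus_char (n - k) t) = V * fourier_coeff q (k - n)" for n
    using V by (simp add: fourier_coeff_torus_char V_def)
  have char_integral: "(LINT t|torus_measure. torus_char (n - k) t) = V * of_bool (k = n)" for n
    by (auto simp: integral_torus_char V_def)
  define q' where "q' = fourier_coeff q"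
  \<comment> \<open>\<open>0 - k\<close> stays unsimplified so that \<open>coeff\<close> and
    \<open>char_integral\<close> treat the leading terms as the case \<open>n = 0\<close>.\<close>
  have "(LINT t|torus_measure. q t * torus_char (0 - k) t - (\<Sum>n\<in>R. \<phi> n * (q t * torus_char (n - k) t))) =
        (LINT t|torus_measure. torus_char (0 - k) t + (\<Sum>n\<in>S. \<theta> n * torus_char (n - k) t))"
  proof (rule integral_cong_AE)
    \<comment> \<open>At zeros of \<Phi> the quotient is 0 by convention and the identity may fail;
      these points form a null set.\<close>
    show "AE t in torus_measure. q t * torus_char (0 - k) t - (\<Sum>n\<in>R. \<phi> n * (q t * torus_char (n - k) t)) =
        torus_char (0 - k) t + (\<Sum>n\<in>S. \<theta> n * torus_char (n - k) t)"
      using AE_ar_poly_nonzero [OF assms(1,2), of \<phi>]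
    proof eventually_elim
      case (elim t)
      then have "q t * ar_poly R \<phi> (exp_neg_i t) * torus_char (- k) t =
          ma_poly S \<theta> (exp_neg_i t) * torus_char (- k) t"
        by (simp add: q_def arma_quotient_def)
      then show ?case
        unfolding char_shift [symmetric, of 0] char_shift [symmetric]
        by (simp add: ar_poly_torus ma_poly_torus algebra_simps sum_distrib_left sum_distrib_right)
    qed
  qed (rule borel_imp_torus_measurable, measurable)+
  moreover have "(LINT t|torus_measure. q t * torus_char (0 - k) t - (\<Sum>n\<in>R. \<phi> n * (q t * torus_char (n - k) t))) =
      V * fourier_coeff q (k - 0) - (\<Sum>n\<in>R. \<phi> n * (V * fourier_coeff q (k - n)))"
    by (simp only: Bochner_Integration.integral_diff Bochner_Integration.integral_sum
        Bochner_Integration.integrable_sum integrable_mult_right integral_mult_right_zero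
        integrable_torus_char_mult [OF int_q] coeff)
  moreover have "(LINT t|torus_measure. torus_char (0 - k) t + (\<Sum>n\<in>S. \<theta> n * torus_char (n - k) t)) =
      V * of_bool (k = 0) + (\<Sum>n\<in>S. \<theta> n * (V * of_bool (k = n)))"
    by (simp only: Bochner_Integration.integral_add Bochner_Integration.integral_sum
        Bochner_Integration.integrable_sum integrable_mult_right integral_mult_right_zero
        integrable_torus_char char_integral)
  ultimately have "V * arma_residual R \<phi> S \<theta> q' k = 0"
    unfolding q'_def arma_residual_def by (simp add: right_diff_distrib distrib_left sum_distrib_left mult.left_commute)
  then show ?thesis
    using V by (simp add: q'_def q_def)
qed

text \<open>Summability makes \<Psi> a bounded function and the recursion gives \<Psi> \<Phi> =
  \<Theta> at every point, so the quotient is \<Psi> wherever \<Phi> does not vanish.\<close>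

lemma arma_quotient_of_summable_solution:
  fixes R S :: "(int ^ 'd::finite) set"
  assumes R: "finite R" "0 \<notin> R" and S: "finite S"
    and summable: "(\<lambda>k. cmod (\<psi> k)) summable_on UNIV"
    and residual: "\<And>k. arma_residual R \<phi> S \<theta> \<psi> k = 0"
  shows "torus_L2 (arma_quotient R \<phi> S \<theta>)" and "fourier_coeff (arma_quotient R \<phi> S \<theta>) = \<psi>"
proof -
  define \<Psi> where "\<Psi> t = (\<Sum>\<^sub>\<infinity>k. \<psi> k * torus_char k t)" for t :: "real ^ 'd"
  have abs: "(\<lambda>k. norm (\<psi> k * torus_char k t)) summable_on UNIV" for t
    using summable by (simp add: norm_mult)
  have \<Psi>: "((\<lambda>k. \<psi> k * torus_char k t) has_sum \<Psi> t) UNIV" for t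
    unfolding \<Psi>_def by (rule has_sum_infsum [OF abs_summable_summable [OF abs]])
  have eq: "\<Psi> t * ar_poly R \<phi> (exp_neg_i t) = ma_poly S \<theta> (exp_neg_i t)" for t
  proof -
    have "((\<lambda>k. \<psi> k * torus_char (k + n) t) has_sum \<Psi> t * torus_char n t) UNIV" for n
      using has_sum_cmult_left [OF \<Psi>, of t "torus_char n t"] by (simp add: torus_char_add mult.assoc)
    from has_sum_arma_residual [where w = "\<lambda>k. torus_char k t", OF R(1) S this, of \<phi> \<theta>]
    have "((\<lambda>k. 0) has_sum ((\<Psi> t * torus_char 0 t - (\<Sum>n\<in>R. \<phi> n * (\<Psi> t * torus_char n t))) -
        (torus_char 0 t + (\<Sum>n\<in>S. \<theta> n * torus_char n t)))) (UNIV :: (int ^ 'd) set)"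
      by (simp add: residual)
    from has_sum_unique [OF this has_sum_0_simp] show ?thesis
      by (simp add: ar_poly_torus ma_poly_torus algebra_simps sum_distrib_left)
  qed
  have q_eq: "arma_quotient R \<phi> S \<theta> t = \<Psi> t" if "ar_poly R \<phi> (exp_neg_i t) \<noteq> 0" for t
    using that by (simp add: arma_quotient_def eq [symmetric])
  show "fourier_coeff (arma_quotient R \<phi> S \<theta>) = \<psi>"
    using AE_ar_poly_nonzero [OF R, of \<phi>]
    by (intro fourier_coeff_eq_if_series summable) (auto simp: q_eq \<Psi>_def [symmetric] elim!: eventually_mono)
  define B where "B = (\<Sum>\<^sub>\<infinity>k. cmod (\<psi> k))"
  have "cmod (\<Psi> t) \<le> B" for t
    using norm_infsum_bound [OF abs, of t] by (simp add: \<Psi>_def B_def norm_mult)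
  moreover have "0 \<le> B"
    by (simp add: B_def infsum_nonneg)
  \<comment> \<open>At zeros of the denominator the quotient is 0, so \<open>0 \<le> B\<close>
    extends the bound to every point.\<close>
  ultimately have bound: "cmod (arma_quotient R \<phi> S \<theta> t) \<le> B" for t
    using q_eq [of t] by (cases "ar_poly R \<phi> (exp_neg_i t) = 0") (auto simp: arma_quotient_def)
  interpret finite_measure "torus_measure :: (real ^ 'd) measure" by (rule finite_measure_torus)
  have "integrable torus_measure (\<lambda>t. (cmod (arma_quotient R \<phi> S \<theta> t))\<^sup>2)"
    using bound
    by (intro integrable_const_bound [where B = "B\<^sup>2"] AE_I2 borel_imp_torus_measurable)
       (auto intro!: power_mono)
  then show "torus_L2 (arma_quotient R \<phi> S \<theta>)"
    unfolding torus_L2_def by (intro conjI borel_imp_torus_measurable) auto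
qed

section \<open>Series with independent identically distributed noise\<close>

text \<open>Multiply \<open>1 + u \<le> exp u\<close> by \<open>1 - u / 2\<close>; the left side
  becomes \<open>1 + u * (1 - u) / 2\<close>, at least 1 on the unit interval.\<close>

lemma exp_minus_le_one_minus_half:
  fixes u :: real
  assumes "0 \<le> u" "u \<le> 1"
  shows "exp (- u) \<le> 1 - u / 2"
proof -
  have "(1 - u / 2) * exp u \<ge> (1 - u / 2) * (1 + u)"
    using assms by (intro mult_left_mono) auto
  also have "(1 - u / 2) * (1 + u) = 1 + u * (1 - u) / 2"
    by (simp add: field_simps)
  also have "\<dots> \<ge> 1" using assms by simp
  finally show ?thesis
    by (simp add: exp_minus field_simps)
qed

text \<open>Only finitely many indices have \<open>1 \<le> f i\<close>, since each adds 1 to the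
  truncated sum; elsewhere truncation changes nothing.\<close>

lemma summable_on_if_summable_on_min_1:
  fixes f :: "'i \<Rightarrow> real"
  assumes nonneg: "\<And>i. 0 \<le> f i" and min: "(\<lambda>i. min 1 (f i)) summable_on A"
  shows "f summable_on A"
proof -
  have bound: "finite {i \<in> A. 1 \<le> f i}"
  proof (rule ccontr)
    assume "infinite {i \<in> A. 1 \<le> f i}"
    \<comment> \<open>The cardinality is chosen to exceed the truncated sum, to which each member of
      \<open>F\<close> contributes exactly 1.\<close>
    then obtain F where F: "F \<subseteq> {i \<in> A. 1 \<le> f i}" "finite F"
        "card F = Suc (nat \<lceil>\<Sum>\<^sub>\<infinity>i\<in>A. min 1 (f i)\<rceil>)"
      using infinite_arbitrarily_large by metis
    have "real (card F) = (\<Sum>i\<in>F. min 1 (f i))"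
      using F(1) by (subst sum.cong [where h = "\<lambda>_. 1", OF refl]) auto
    also have "\<dots> \<le> (\<Sum>\<^sub>\<infinity>i\<in>A. min 1 (f i))"
      using F nonneg by (intro finite_sum_le_infsum min) auto
    finally show False
      using F(3) by linarith
  qed
  have "(\<lambda>i. min 1 (f i)) summable_on (A - {i \<in> A. 1 \<le> f i})"
    using min by (rule summable_on_subset_banach) auto
  then have "f summable_on (A - {i \<in> A. 1 \<le> f i})"
    by (rule summable_on_cong [THEN iffD1, rotated]) auto
  moreover have "f summable_on {i \<in> A. 1 \<le> f i}"
    using bound by (rule summable_on_finite)
  ultimately have "f summable_on ((A - {i \<in> A. 1 \<le> f i}) \<union> {i \<in> A. 1 \<le> f i})"
    by (intro summable_on_Un_disjoint) auto
  then show ?thesis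
    by (rule back_subst [of "\<lambda>A. f summable_on A"]) auto
qed

context prob_space
begin

text \<open>
  With \<open>W\<close> the a.s. finite sum of the moduli, \<open>E exp (- W) > 0\<close> is a lower bound for the products of
  the factors \<open>E exp (- |c i| |X i|) \<le> exp (- \<kappa> min 1 |c i|)\<close>, so the exponents are summable.
\<close>

lemma coefficients_abs_summable:
  fixes X :: "'i::countable \<Rightarrow> 'a \<Rightarrow> complex"
  assumes X: "iid_field M X"
    and nz: "\<not> (AE \<omega> in M. X i0 \<omega> = 0)"
    and summable: "AE \<omega> in M. (\<lambda>i. cmod (c i * X i \<omega>)) summable_on UNIV"
  shows "(\<lambda>i. cmod (c i)) summable_on UNIV"
proof (rule summable_on_if_summable_on_min_1)
  have X_meas [measurable]: "X i \<in> borel_measurable M" for i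
    using X by (auto simp: iid_field_def random_field_def)
  have indep: "indep_vars (\<lambda>_. borel) X UNIV"
    using X by (simp add: iid_field_def)
  have dist: "distr M borel (X i) = distr M borel (X j)" for i j
    using X by (auto simp: iid_field_def)
  \<comment> \<open>Truncation makes the expectation finite without any moment assumption, and
    \<open>nz\<close> makes it positive. The factor 1/2 comes from
    \<open>exp_minus_le_one_minus_half\<close>.\<close>
  define \<kappa> where "\<kappa> = expectation (\<lambda>\<omega>. min 1 (cmod (X i0 \<omega>))) / 2"
  have int_min: "integrable M (\<lambda>\<omega>. min 1 (cmod (X i \<omega>)))" for i
    by (rule integrable_const_bound [where B = 1]) auto
  have "expectation (\<lambda>\<omega>. min 1 (cmod (X i0 \<omega>))) \<noteq> 0"
  proof
    assume "expectation (\<lambda>\<omega>. min 1 (cmod (X i0 \<omega>))) = 0"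
    then have "AE \<omega> in M. min 1 (cmod (X i0 \<omega>)) = 0"
      by (subst (asm) integral_nonneg_eq_0_iff_AE [OF int_min]) auto
    then have "AE \<omega> in M. X i0 \<omega> = 0"
      by eventually_elim (simp add: min_def split: if_splits)
    with nz show False ..
  qed
  moreover have "expectation (\<lambda>\<omega>. min 1 (cmod (X i0 \<omega>))) \<ge> 0"
    by (intro Bochner_Integration.integral_nonneg) auto
  ultimately have \<kappa>: "\<kappa> > 0"
    unfolding \<kappa>_def by linarith
  have int_exp: "integrable M (\<lambda>\<omega>. exp (- (cmod (c i * X i \<omega>))))" for i
    by (rule integrable_const_bound [where B = 1]) auto
  have factor: "expectation (\<lambda>\<omega>. exp (- (cmod (c i * X i \<omega>)))) \<le> exp (- (\<kappa> * min 1 (cmod (c i))))" for i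
  proof -
    define y where "y = min 1 (cmod (c i))"
    have y: "0 \<le> y" "y \<le> 1" "y \<le> cmod (c i)"
      by (auto simp: y_def)
    have pt: "exp (- (cmod (c i * x))) \<le> 1 - y * min 1 (cmod x) / 2" for x
    proof -
      have "y * min 1 (cmod x) \<le> cmod (c i) * cmod x"
        using y by (intro mult_mono) auto
      then have "exp (- (cmod (c i * x))) \<le> exp (- (y * min 1 (cmod x)))"
        by (simp add: norm_mult)
      also have "\<dots> \<le> 1 - y * min 1 (cmod x) / 2"
        using y by (intro exp_minus_le_one_minus_half) (auto simp: mult_le_one)
      finally show ?thesis .
    qed
    have "expectation (\<lambda>\<omega>. exp (- (cmod (c i * X i \<omega>)))) \<le> expectation (\<lambda>\<omega>. 1 - y * min 1 (cmod (X i \<omega>)) / 2)"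
      using int_min by (intro integral_mono int_exp pt) auto
    also have "\<dots> = 1 - y * expectation (\<lambda>\<omega>. min 1 (cmod (X i \<omega>))) / 2"
      using int_min by (simp add: prob_space)
    \<comment> \<open>Passing through the common law replaces \<open>X i\<close> by
      \<open>X i0\<close>, so one \<kappa> serves every index.\<close>
    also have "expectation (\<lambda>\<omega>. min 1 (cmod (X i \<omega>))) = (LINT x|distr M borel (X i). min 1 (cmod x))"
      by (subst integral_distr) auto
    also have "\<dots> = (LINT x|distr M borel (X i0). min 1 (cmod x))"
      by (simp only: dist [of i i0])
    also have "\<dots> = expectation (\<lambda>\<omega>. min 1 (cmod (X i0 \<omega>)))"
      by (subst integral_distr) auto
    also have "1 - y * expectation (\<lambda>\<omega>. min 1 (cmod (X i0 \<omega>))) / 2 = 1 + - (\<kappa> * y)"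
      by (simp add: \<kappa>_def)
    also have "\<dots> \<le> exp (- (\<kappa> * y))"
      by (rule exp_ge_add_one_self)
    finally show ?thesis
      by (simp add: y_def)
  qed
  define W where "W \<omega> = (\<Sum>\<^sub>\<infinity>i. cmod (c i * X i \<omega>))" for \<omega>
  have W_meas [measurable]: "W \<in> borel_measurable M"
    unfolding W_def by (intro borel_measurable_infsum) auto
  have W_nonneg: "0 \<le> W \<omega>" for \<omega>
    by (simp add: W_def infsum_nonneg)
  have int_W: "integrable M (\<lambda>\<omega>. exp (- W \<omega>))"
    by (rule integrable_const_bound [where B = 1]) (auto simp: W_nonneg)
  define \<delta> where "\<delta> = expectation (\<lambda>\<omega>. exp (- W \<omega>))"
  \<comment> \<open>\<open>W\<close> is real everywhere, being 0 where the series diverges, so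
    \<open>exp (- W \<omega>)\<close> is strictly positive and its integral cannot vanish.\<close>
  have "\<delta> \<noteq> 0"
    unfolding \<delta>_def by (subst integral_nonneg_eq_0_iff_AE [OF int_W]) (auto simp: AE_False)
  moreover have "\<delta> \<ge> 0"
    unfolding \<delta>_def by (intro Bochner_Integration.integral_nonneg) auto
  ultimately have \<delta>: "\<delta> > 0" by simp
  \<comment> \<open>The bound is uniform in \<open>F\<close>, which is all that summability of
    nonnegative terms requires.\<close>
  have "(\<Sum>i\<in>F. min 1 (cmod (c i))) \<le> - ln \<delta> / \<kappa>" if F: "finite F" for F
  proof -
    have indep_F: "indep_vars (\<lambda>_. borel) (\<lambda>i \<omega>. exp (- (cmod (c i * X i \<omega>)))) F"
      by (rule indep_vars_compose2 [OF indep_vars_subset [OF indep]]) auto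
    have "\<delta> \<le> expectation (\<lambda>\<omega>. \<Prod>i\<in>F. exp (- (cmod (c i * X i \<omega>))))"
      unfolding \<delta>_def
    proof (rule integral_mono_AE [OF int_W])
      show "integrable M (\<lambda>\<omega>. \<Prod>i\<in>F. exp (- (cmod (c i * X i \<omega>))))"
        by (rule indep_vars_integrable [OF F indep_F]) (rule int_exp)
      show "AE \<omega> in M. exp (- W \<omega>) \<le> (\<Prod>i\<in>F. exp (- (cmod (c i * X i \<omega>))))"
        using summable
      proof eventually_elim
        case (elim \<omega>)
        then have "(\<Sum>i\<in>F. cmod (c i * X i \<omega>)) \<le> W \<omega>"
          unfolding W_def using F by (intro finite_sum_le_infsum) auto
        then show ?case
          using F by (simp add: exp_sum [symmetric] sum_negf)
      qed
    qed
    also have "\<dots> = (\<Prod>i\<in>F. expectation (\<lambda>\<omega>. exp (- (cmod (c i * X i \<omega>)))))"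
      by (rule indep_vars_lebesgue_integral [OF F indep_F]) (rule int_exp)
    also have "\<dots> \<le> (\<Prod>i\<in>F. exp (- (\<kappa> * min 1 (cmod (c i)))))"
      by (intro prod_mono conjI factor Bochner_Integration.integral_nonneg) auto
    also have "\<dots> = exp (- (\<kappa> * (\<Sum>i\<in>F. min 1 (cmod (c i)))))"
      using F by (simp add: exp_sum [symmetric] sum_negf sum_distrib_left)
    finally have "ln \<delta> \<le> ln (exp (- (\<kappa> * (\<Sum>i\<in>F. min 1 (cmod (c i))))))"
      using \<delta> by (subst ln_le_cancel_iff) auto
    then show ?thesis
      using \<kappa> by (simp add: field_simps)
  qed
  then show "(\<lambda>i. min 1 (cmod (c i))) summable_on UNIV"
    by (intro nonneg_bounded_partial_sums_imp_summable_on eventually_finite_subsets_at_top_weakI) auto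
qed simp

text \<open>The joint law is the product of the marginals and is concentrated on the diagonal. So
  for almost every \<open>x\<close> the law of \<open>Y\<close> is concentrated at \<open>x\<close>,
  and any such \<open>x\<close> is the constant.\<close>

lemma indep_AE_eq_imp_AE_constant:
  fixes X Y :: "'a \<Rightarrow> complex"
  assumes indep: "indep_var borel X borel Y" and eq: "AE \<omega> in M. X \<omega> = Y \<omega>"
  shows "\<exists>c. AE \<omega> in M. X \<omega> = c"
proof -
  have [measurable]: "X \<in> borel_measurable M" "Y \<in> borel_measurable M"
    and prod: "distr M borel X \<Otimes>\<^sub>M distr M borel Y = distr M (borel \<Otimes>\<^sub>M borel) (\<lambda>\<omega>. (X \<omega>, Y \<omega>))"
    using indep by (auto simp: indep_var_distribution_eq)
  interpret X: prob_space "distr M borel X" by (rule prob_space_distr) simp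
  interpret Y: prob_space "distr M borel Y" by (rule prob_space_distr) simp
  interpret pair_sigma_finite "distr M borel X" "distr M borel Y" ..
  have "AE p in distr M (borel \<Otimes>\<^sub>M borel) (\<lambda>\<omega>. (X \<omega>, Y \<omega>)). fst p = snd p"
    using eq by (subst AE_distr_iff) auto
  then have "AE x in distr M borel X. AE y in distr M borel Y. x = y"
    unfolding prod [symmetric] by (auto dest: AE_pair)
  then obtain c where "AE y in distr M borel Y. c = y"
    using X.AE_False by (metis (mono_tags, lifting) eventually_mono)
  then have "AE \<omega> in M. c = Y \<omega>"
    by (subst (asm) AE_distr_iff) auto
  with eq have "AE \<omega> in M. X \<omega> = c"
    by eventually_elim simp
  then show ?thesis ..
qed

text \<open>If \<open>c i\<close> were nonzero, solving for \<open>X i\<close> would make it almost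
  surely a function of the other variables, which are independent of it.\<close>

lemma AE_linear_series_zero_imp_coefficients_zero:
  fixes X :: "'i::countable \<Rightarrow> 'a \<Rightarrow> complex"
  assumes X: "iid_field M X"
    and nc: "\<not> as_constant M (X i)"
    and zero: "AE \<omega> in M. ((\<lambda>i. c i * X i \<omega>) has_sum 0) UNIV"
  shows "c i = 0"
proof (rule ccontr)
  assume "c i \<noteq> 0"
  have indep: "indep_vars (\<lambda>_. borel) X UNIV"
    using X by (simp add: iid_field_def)
  \<comment> \<open>\<open>infsum\<close> is total, so \<open>g\<close> is measurable on the whole
    product space; its value matters only where the series converges.\<close>
  define g :: "('i \<Rightarrow> complex) \<Rightarrow> complex" where "g x = - (\<Sum>\<^sub>\<infinity>j\<in>UNIV - {i}. c j * x j) / c i" for x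
  have "g \<in> borel_measurable (Pi\<^sub>M (UNIV - {i}) (\<lambda>_. borel))"
    unfolding g_def
    by (intro borel_measurable_divide borel_measurable_uminus borel_measurable_infsum_complex) auto
  moreover have "(\<lambda>x. x i) \<in> borel_measurable (Pi\<^sub>M {i} (\<lambda>_. borel))"
    by simp
  ultimately have "indep_var borel ((\<lambda>x. x i) \<circ> (\<lambda>\<omega>. \<lambda>j\<in>{i}. X j \<omega>)) borel (g \<circ> (\<lambda>\<omega>. \<lambda>j\<in>UNIV - {i}. X j \<omega>))"
    by (intro indep_var_compose [OF indep_var_restrict [OF indep]]) auto
  moreover have "(\<lambda>x. x i) \<circ> (\<lambda>\<omega>. \<lambda>j\<in>{i}. X j \<omega>) = X i"
    by auto
  moreover have "AE \<omega> in M. X i \<omega> = (g \<circ> (\<lambda>\<omega>. \<lambda>j\<in>UNIV - {i}. X j \<omega>)) \<omega>"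
    using zero
  proof eventually_elim
    case (elim \<omega>)
    then have "((\<lambda>j. c j * X j \<omega>) has_sum (0 - c i * X i \<omega>)) (UNIV - {i})"
      by (intro has_sum_Diff) (auto simp: has_sum_finite_iff)
    then have "(\<Sum>\<^sub>\<infinity>j\<in>UNIV - {i}. c j * X j \<omega>) = - (c i * X i \<omega>)"
      by (simp add: infsumI)
    moreover have "(\<Sum>\<^sub>\<infinity>j\<in>UNIV - {i}. c j * (\<lambda>j\<in>UNIV - {i}. X j \<omega>) j) = (\<Sum>\<^sub>\<infinity>j\<in>UNIV - {i}. c j * X j \<omega>)"
      by (intro infsum_cong) auto
    ultimately show ?case
      using \<open>c i \<noteq> 0\<close> by (simp add: g_def)
  qed
  ultimately have "\<exists>c. AE \<omega> in M. X i \<omega> = c"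
    by (metis indep_AE_eq_imp_AE_constant)
  then show False
    using nc by (simp add: as_constant_def)
qed

end

text \<open>Almost sure constancy depends on the law alone. This carries nonconstancy from index 0
  to every index.\<close>

lemma iid_field_as_constant:
  assumes X: "iid_field M X" and c: "as_constant M (X i)"
  shows "as_constant M (X j)"
proof -
  have [measurable]: "X k \<in> borel_measurable M" for k
    using X by (auto simp: iid_field_def random_field_def)
  obtain c where "AE \<omega> in M. X i \<omega> = c"
    using c by (auto simp: as_constant_def)
  then have "AE x in distr M borel (X i). x = c"
    by (subst AE_distr_iff) auto
  also have "distr M borel (X i) = distr M borel (X j)"
    using X by (auto simp: iid_field_def)
  finally have "AE \<omega> in M. X j \<omega> = c"
    by (subst (asm) AE_distr_iff) auto
  then show ?thesis
    by (auto simp: as_constant_def)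
qed

section \<open>Linear fields and the ARMA equation\<close>

lemma AE_linear_field_residual:
  assumes R: "finite R" and S: "finite S" and conv: "linear_series_conv M \<psi> Z"
  shows "AE \<omega> in M. ((\<lambda>k. arma_residual R \<phi> S \<theta> \<psi> k * Z (t - k) \<omega>) has_sum
    ((linear_field \<psi> Z t \<omega> - (\<Sum>n\<in>R. \<phi> n * linear_field \<psi> Z (t - n) \<omega>)) -
     (Z t \<omega> + (\<Sum>n\<in>S. \<theta> n * Z (t - n) \<omega>)))) UNIV"
proof -
  \<comment> \<open>Only finitely many lags occur, so one almost sure event serves all of
    them.\<close>
  have "AE \<omega> in M. \<forall>n\<in>insert 0 R. (\<lambda>k. cmod (\<psi> k * Z (t - n - k) \<omega>)) summable_on UNIV"
    using R conv by (intro AE_finite_allI) (auto simp: linear_series_conv_def)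
  then show ?thesis
  proof eventually_elim
    case (elim \<omega>)
    have "((\<lambda>k. \<psi> k * Z (t - (k + n)) \<omega>) has_sum linear_field \<psi> Z (t - n) \<omega>) UNIV" if "n \<in> insert 0 R" for n
    proof -
      have abs: "(\<lambda>k. cmod (\<psi> k * Z (t - n - k) \<omega>)) summable_on UNIV"
        using elim that by blast
      have "((\<lambda>k. \<psi> k * Z (t - n - k) \<omega>) has_sum linear_field \<psi> Z (t - n) \<omega>) UNIV"
        unfolding linear_field_def by (rule has_sum_infsum [OF abs_summable_summable [OF abs]])
      then show ?thesis
        by (simp add: diff_diff_eq add.commute)
    qed
    from has_sum_arma_residual [where w = "\<lambda>k. Z (t - k) \<omega>", OF R S this] show ?case
      by simp
  qed
qed

text \<open>The residuals of the Fourier coefficients vanish, so the difference of the two sides of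
  the equation is the sum of the zero family.\<close>

lemma linear_stationary_solution_linear_field:
  assumes "finite R" "0 \<notin> R" "finite S" and Z: "random_field M Z"
    and L2: "torus_L2 (arma_quotient R \<phi> S \<theta>)"
    and conv: "linear_series_conv M (fourier_coeff (arma_quotient R \<phi> S \<theta>)) Z"
  shows "linear_stationary_solution M R \<phi> S \<theta> Z (linear_field (fourier_coeff (arma_quotient R \<phi> S \<theta>)) Z)"
proof -
  define \<psi> where "\<psi> = fourier_coeff (arma_quotient R \<phi> S \<theta>)"
  have "AE \<omega> in M. linear_field \<psi> Z t \<omega> - (\<Sum>n\<in>R. \<phi> n * linear_field \<psi> Z (t - n) \<omega>) =
      Z t \<omega> + (\<Sum>n\<in>S. \<theta> n * Z (t - n) \<omega>)" for t
    using AE_linear_field_residual [OF assms(1,3) conv, of \<phi> \<theta> t]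
  proof eventually_elim
    case (elim \<omega>)
    then have "((\<lambda>_ :: int ^ 'a. 0) has_sum
        ((linear_field \<psi> Z t \<omega> - (\<Sum>n\<in>R. \<phi> n * linear_field \<psi> Z (t - n) \<omega>)) -
          (Z t \<omega> + (\<Sum>n\<in>S. \<theta> n * Z (t - n) \<omega>)))) UNIV"
      by (simp add: arma_residual_fourier_coeff [OF assms(1-3) L2] \<psi>_def)
    from has_sum_unique [OF this has_sum_0_simp] show ?case by simp
  qed
  moreover have "linear_field \<psi> Z t \<in> borel_measurable M" for t
    using Z unfolding linear_field_def [abs_def] random_field_def
    by (intro borel_measurable_infsum_complex borel_measurable_times) auto
  ultimately show ?thesis
    using conv unfolding linear_stationary_solution_def solves_arma_def random_field_def \<psi>_def
    by blast
qed

text \<open>The equation at time 0 already forces every residual to vanish. The coefficients of the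
  given solution are then the Fourier coefficients, so its convergence carries over.\<close>

lemma (in prob_space) linear_stationary_solution_imp:
  fixes Z :: "int ^ 'd::finite \<Rightarrow> 'a \<Rightarrow> complex"
  assumes R: "finite R" "0 \<notin> R" and S: "finite S" and Z: "iid_field M Z"
    and nc: "\<not> as_constant M (Z 0)"
    and sol: "linear_stationary_solution M R \<phi> S \<theta> Z Y"
  shows "torus_L2 (arma_quotient R \<phi> S \<theta>)"
    and "linear_series_conv M (fourier_coeff (arma_quotient R \<phi> S \<theta>)) Z"
proof -
  obtain \<psi> where conv: "linear_series_conv M \<psi> Z"
    and Y: "\<And>t. AE \<omega> in M. Y t \<omega> = linear_field \<psi> Z t \<omega>"
    and arma: "\<And>t. AE \<omega> in M. Y t \<omega> - (\<Sum>n\<in>R. \<phi> n * Y (t - n) \<omega>) = Z t \<omega> + (\<Sum>n\<in>S. \<theta> n * Z (t - n) \<omega>)"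
    using sol by (auto simp: linear_stationary_solution_def solves_arma_def)
  \<comment> \<open>At time 0 the noise carries index \<open>- k\<close>; reflection reindexes the
    series by the noise variable, as the lemmas on i.i.d. series require.\<close>
  have bij: "bij_betw uminus UNIV (UNIV :: (int ^ 'd) set)"
    by (rule bij_betwI [where g = uminus]) auto
  have "(\<lambda>k. cmod (\<psi> (- k))) summable_on UNIV"
  proof (rule coefficients_abs_summable [OF Z])
    show "\<not> (AE \<omega> in M. Z 0 \<omega> = 0)"
      using nc by (auto simp: as_constant_def)
    have "AE \<omega> in M. (\<lambda>k. cmod (\<psi> k * Z (0 - k) \<omega>)) summable_on UNIV"
      using conv unfolding linear_series_conv_def by blast
    then show "AE \<omega> in M. (\<lambda>k. cmod (\<psi> (- k) * Z k \<omega>)) summable_on UNIV"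
    proof eventually_elim
      case (elim \<omega>)
      with summable_on_reindex_bij_betw [OF bij, of "\<lambda>k. cmod (\<psi> k * Z (- k) \<omega>)"]
      show ?case by simp
    qed
  qed
  then have summable: "(\<lambda>k. cmod (\<psi> k)) summable_on UNIV"
    using summable_on_reindex_bij_betw [OF bij, of "\<lambda>k. cmod (\<psi> k)"] by simp
  have Y_all: "AE \<omega> in M. \<forall>n\<in>insert 0 R. Y (0 - n) \<omega> = linear_field \<psi> Z (0 - n) \<omega>"
    using R Y by (intro AE_finite_allI) auto
  have zero: "AE \<omega> in M. ((\<lambda>k. arma_residual R \<phi> S \<theta> \<psi> (- k) * Z k \<omega>) has_sum 0) UNIV"
    using AE_linear_field_residual [OF R(1) S conv, of \<phi> \<theta> 0] arma [of 0] Y_all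
  proof eventually_elim
    case (elim \<omega>)
    have "(\<Sum>n\<in>R. \<phi> n * Y (0 - n) \<omega>) = (\<Sum>n\<in>R. \<phi> n * linear_field \<psi> Z (0 - n) \<omega>)"
      using elim(3) by (intro sum.cong) auto
    moreover have "Y 0 \<omega> = linear_field \<psi> Z 0 \<omega>"
      using elim(3) by simp
    ultimately have "((\<lambda>k. arma_residual R \<phi> S \<theta> \<psi> k * Z (- k) \<omega>) has_sum 0) UNIV"
      using elim(1,2) by simp
    then show ?case
      using has_sum_reindex_bij_betw [OF bij, of "\<lambda>k. arma_residual R \<phi> S \<theta> \<psi> k * Z (- k) \<omega>"] by simp
  qed
  have "arma_residual R \<phi> S \<theta> \<psi> (- k) = 0" for k
    using AE_linear_series_zero_imp_coefficients_zero [OF Z _ zero, of k] iid_field_as_constant [OF Z, of k 0] nc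
    by blast
  then have "arma_residual R \<phi> S \<theta> \<psi> k = 0" for k
    by (metis minus_minus)
  note q = arma_quotient_of_summable_solution [OF R S summable this]
  show "torus_L2 (arma_quotient R \<phi> S \<theta>)" by (rule q(1))
  show "linear_series_conv M (fourier_coeff (arma_quotient R \<phi> S \<theta>)) Z"
    using conv by (simp add: q(2))
qed

text \<open>Nonconstancy guards only the equivalence; sufficiency with the explicit solution is the
  second conjunct and covers constant noise as well.\<close>

theorem theorem2p2:
  fixes M :: "'a measure"
    and R S :: "(int ^ 'd::finite) set"
    and \<phi> \<theta> :: "int ^ 'd \<Rightarrow> complex"
    and Z :: "int ^ 'd \<Rightarrow> 'a \<Rightarrow> complex"
  assumes "prob_space M"
    and "finite R" and "0 \<notin> R"
    and "finite S" and "0 \<notin> S"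
    and "iid_field M Z"
  shows "(\<not> as_constant M (Z 0) \<longrightarrow>
          ((\<exists>Y. linear_stationary_solution M R \<phi> S \<theta> Z Y) \<longleftrightarrow>
           (torus_L2 (arma_quotient R \<phi> S \<theta>) \<and>
            linear_series_conv M (fourier_coeff (arma_quotient R \<phi> S \<theta>)) Z)))
       \<and> (torus_L2 (arma_quotient R \<phi> S \<theta>) \<and>
          linear_series_conv M (fourier_coeff (arma_quotient R \<phi> S \<theta>)) Z \<longrightarrow>
          linear_stationary_solution M R \<phi> S \<theta> Z
            (linear_field (fourier_coeff (arma_quotient R \<phi> S \<theta>)) Z))"
proof -
  interpret prob_space M by fact
  have Z: "random_field M Z"
    using assms(6) by (simp add: iid_field_def)
  show ?thesis
    using linear_stationary_solution_linear_field [OF assms(2-4) Z]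
      linear_stationary_solution_imp [OF assms(2-4,6)]
    by blast
qed

end
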